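(* Let $\mathbf{F}:\mathbb{R}^n\to\overline{I(\mathbb{R})}$ be a $gH$-lower semicontinuous and convex interval-valued function. Let $\bar S$ and $S$ be two nonempty closed convex sets with $\bar S\subseteq S\subseteq\mathbb{R}^n$, and suppose $\operatorname{dom}(\mathbf{F})\cap S\neq\emptyset$. Define $\mathbf{F}_o:\mathbb{R}^n\to\overline{I(\mathbb{R})}$ by $\mathbf{F}_o(x)=\mathbf{F}(x)$ if $x\in S$ and $\mathbf{F}_o(x)=+\infty$ otherwise. Let $\alpha>0$. Then $\bar S$ is a set of weak sharp minima of $\mathbf{F}$ over $S$ with modulus $\alpha$ if and only if $$\alpha\,\operatorname{dist}(d,T_{\bar S}(x))\preceq \mathbf{F}_{o\mathscr{D}}(x)(d)\quad\text{for all }x\in\bar S\text{ and } d\in\mathbb{R}^n,$$ where $\mathbf{F}_{o\mathscr{D}}(x)(d)$ denotes the $gH$-directional derivative of $\mathbf{F}_o$ at $x$ in the direction $d$.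
   Context: $I(\mathbb{R})$ is the set of closed bounded intervals $\mathbf{A}=[\underline a,\overline a]$; a real number $p$ is identified with $[p,p]$. For $\mathbf{A}=[\underline a,\overline a]$, $\mathbf{B}=[\underline b,\overline b]$: $\mathbf{A}\oplus\mathbf{B}=[\underline a+\underline b,\overline a+\overline b]$; $\lambda\odot\mathbf{A}=[\lambda\underline a,\lambda\overline a]$ if $\lambda\ge0$ and $[\lambda\overline a,\lambda\underline a]$ if $\lambda<0$; $\mathbf{A}\ominus_{gH}\mathbf{B}=[\min\{\underline a-\underline b,\overline a-\overline b\},\max\{\underline a-\underline b,\overline a-\overline b\}]$; $\mathbf{A}\preceq\mathbf{B}$ iff $\underline a\le\underline b$ and $\overline a\le\overline b$; $\mathbf{A}\prec\mathbf{B}$ iff $\mathbf{A}\preceq\mathbf{B}$ and $\mathbf{A}\ne\mathbf{B}$. $\overline{I(\mathbb{R})}=I(\mathbb{R})\cup\{-\infty,+\infty\}$, with $\pm\infty$ identified with $[\pm\infty,\pm\infty]$; the order, operations, suprema, infima and limits are taken endpointwise in the extended reals. For an extended interval-valued function $\mathbf{F}$ on $X\subseteq\mathbb{R}^n$: $\operatorname{dom}(\mathbf{F})=\{x\in X:\mathbf{F}(x)\prec[+\infty,+\infty]\}$. $\mathbf{F}$ is convex on a convex set $X$ if $\mathbf{F}(\lambda_1x_1+\lambda_2x_2)\preceq\lambda_1\odot\mathbf{F}(x_1)\oplus\lambda_2\odot\mathbf{F}(x_2)$ for all $x_1,x_2\in X$ and $\lambda_1,\lambda_2\in[0,1]$ with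 $\lambda_1+\lambda_2=1$. $\mathbf{F}$ is $gH$-lower semicontinuous if at every $\bar x$, $\mathbf{F}(\bar x)\preceq\liminf_{x\to\bar x}\mathbf{F}(x):=\sup_{\delta>0}\inf\{\mathbf{F}(x):x\in B_\delta(\bar x)\}$, with $B_\delta(\bar x)$ the open ball of radius $\delta$ centred at $\bar x$. The $gH$-directional derivative of $\mathbf{F}$ at $\bar x$ in direction $d\in\mathbb{R}^n$ is $\mathbf{F}_{\mathscr{D}}(\bar x)(d)=\lim_{\lambda\to0+}\frac1\lambda\odot(\mathbf{F}(\bar x+\lambda d)\ominus_{gH}\mathbf{F}(\bar x))$. $\operatorname{dist}(y,C)=\inf_{c\in C}\|y-c\|$ (Euclidean norm). For a nonempty closed convex set $A$ and $x\in A$, the tangent cone is $T_A(x)=\operatorname{cl}\left(\bigcup_{t>0}\frac{A-x}{t}\right)$. Weak sharp minima: $\bar S$ is a set of weak sharp minima of $\mathbf{F}$ over $S$ with modulus $\alpha>0$ if $\mathbf{F}(\bar x)\oplus\alpha\operatorname{dist}(x,\bar S)\preceq\mathbf{F}(x)$ for all $\bar x\in\bar S$ and $x\in S$. *)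

theory Defs
  imports "HOL-Analysis.Analysis" "HOL-Library.Interval"
begin

text \<open>
  Intervals are elements of \<^typ>\<open>ereal interval\<close>: this type also contains half-infinite intervals,
  which arise as endpointwise infima and limits. Addition of intervals and the embedding
  \<^const>\<open>interval_of\<close> of points are those of the library. The library order \<open>\<le>\<close> on intervals is
  inclusion, so the endpointwise order needs a separate notation.
\<close>

definition IR :: "ereal interval set" where
  "IR = {A. \<exists>a b::real. lower A = ereal a \<and> upper A = ereal b}"

definition IR_ext :: "ereal interval set" where
  "IR_ext = IR \<union> {interval_of (- \<infinity>), interval_of \<infinity>}"

definition ivl_le :: "ereal interval \<Rightarrow> ereal interval \<Rightarrow> bool" (infix \<open>\<preceq>\<close> 50) where
  "A \<preceq> B \<longleftrightarrow> lower A \<le> lower B \<and> upper A \<le> upper B"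

definition ivl_less :: "ereal interval \<Rightarrow> ereal interval \<Rightarrow> bool" (infix \<open>\<prec>\<close> 50) where
  "A \<prec> B \<longleftrightarrow> A \<preceq> B \<and> A \<noteq> B"

definition ivl_scale :: "real \<Rightarrow> ereal interval \<Rightarrow> ereal interval" (infixr \<open>\<odot>\<^sub>I\<close> 75) where
  "r \<odot>\<^sub>I A =
     (if r \<ge> 0 then Interval (ereal r * lower A, ereal r * upper A)
      else Interval (ereal r * upper A, ereal r * lower A))"

definition ivl_gH_diff :: "ereal interval \<Rightarrow> ereal interval \<Rightarrow> ereal interval"
    (infixl \<open>\<ominus>\<^sub>g\<^sub>H\<close> 65) where
  "A \<ominus>\<^sub>g\<^sub>H B =
     Interval (min (lower A - lower B) (upper A - upper B),
               max (lower A - lower B) (upper A - upper B))"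

definition ivl_Inf :: "ereal interval set \<Rightarrow> ereal interval" where
  "ivl_Inf M = Interval (INF A\<in>M. lower A, INF A\<in>M. upper A)"

definition ivl_Sup :: "ereal interval set \<Rightarrow> ereal interval" where
  "ivl_Sup M = Interval (SUP A\<in>M. lower A, SUP A\<in>M. upper A)"

lemma lower_Interval: "a \<le> b \<Longrightarrow> lower (Interval (a, b)) = a"
  and upper_Interval: "a \<le> b \<Longrightarrow> upper (Interval (a, b)) = b"
  by (simp_all add: lower.rep_eq upper.rep_eq Interval_inverse)

lemma lower_ivl_scale: "lower (r \<odot>\<^sub>I A) = (if r \<ge> 0 then ereal r * lower A else ereal r * upper A)"
  and upper_ivl_scale: "upper (r \<odot>\<^sub>I A) = (if r \<ge> 0 then ereal r * upper A else ereal r * lower A)"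
proof -
  have "ereal r * lower A \<le> ereal r * upper A" if "r \<ge> 0"
    using that by (intro ereal_mult_left_mono) auto
  moreover have "ereal r * upper A \<le> ereal r * lower A" if "r < 0"
  proof -
    have "ereal (- r) * lower A \<le> ereal (- r) * upper A"
      using that by (intro ereal_mult_left_mono) auto
    then have "- (ereal r * lower A) \<le> - (ereal r * upper A)"
      by (metis ereal_mult_minus_left uminus_ereal.simps(1))
    then show ?thesis by simp
  qed
  ultimately show
    "lower (r \<odot>\<^sub>I A) = (if r \<ge> 0 then ereal r * lower A else ereal r * upper A)"
    "upper (r \<odot>\<^sub>I A) = (if r \<ge> 0 then ereal r * upper A else ereal r * lower A)"
    by (auto simp: ivl_scale_def lower_Interval upper_Interval)
qed

lemma lower_ivl_gH_diff: "lower (A \<ominus>\<^sub>g\<^sub>H B) = min (lower A - lower B) (upper A - upper B)"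
  and upper_ivl_gH_diff: "upper (A \<ominus>\<^sub>g\<^sub>H B) = max (lower A - lower B) (upper A - upper B)"
  by (simp_all add: ivl_gH_diff_def lower_Interval upper_Interval min.coboundedI1)

lemma lower_ivl_Inf: "lower (ivl_Inf M) = (INF A\<in>M. lower A)"
  and upper_ivl_Inf: "upper (ivl_Inf M) = (INF A\<in>M. upper A)"
proof -
  have "(INF A\<in>M. lower A) \<le> (INF A\<in>M. upper A)"
    by (rule INF_mono) (auto intro: lower_le_upper)
  then show "lower (ivl_Inf M) = (INF A\<in>M. lower A)" "upper (ivl_Inf M) = (INF A\<in>M. upper A)"
    by (simp_all add: ivl_Inf_def lower_Interval upper_Interval)
qed

lemma lower_ivl_Sup: "lower (ivl_Sup M) = (SUP A\<in>M. lower A)"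
  and upper_ivl_Sup: "upper (ivl_Sup M) = (SUP A\<in>M. upper A)"
proof -
  have "(SUP A\<in>M. lower A) \<le> (SUP A\<in>M. upper A)"
    by (rule SUP_mono) (auto intro: lower_le_upper)
  then show "lower (ivl_Sup M) = (SUP A\<in>M. lower A)" "upper (ivl_Sup M) = (SUP A\<in>M. upper A)"
    by (simp_all add: ivl_Sup_def lower_Interval upper_Interval)
qed

definition ivf_dom :: "'a set \<Rightarrow> ('a \<Rightarrow> ereal interval) \<Rightarrow> 'a set" where
  "ivf_dom X F = {x \<in> X. F x \<prec> interval_of \<infinity>}"

text \<open>
  The arithmetic of \<^typ>\<open>ereal\<close> has \<open>0 * \<infinity> = 0\<close> and \<open>\<infinity> + (- \<infinity>) = \<infinity>\<close>, so the inequality below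
  imposes no restriction when one value is \<open>\<infinity>\<close> and both weights are positive.
\<close>

definition ivf_convex_on :: "'a::real_vector set \<Rightarrow> ('a \<Rightarrow> ereal interval) \<Rightarrow> bool" where
  "ivf_convex_on X F \<longleftrightarrow> convex X \<and>
     (\<forall>x1\<in>X. \<forall>x2\<in>X. \<forall>l1\<in>{0..1}. \<forall>l2\<in>{0..1}. l1 + l2 = 1 \<longrightarrow>
        F (l1 *\<^sub>R x1 + l2 *\<^sub>R x2) \<preceq> l1 \<odot>\<^sub>I F x1 + l2 \<odot>\<^sub>I F x2)"

definition ivf_liminf :: "('a::metric_space \<Rightarrow> ereal interval) \<Rightarrow> 'a \<Rightarrow> ereal interval" where
  "ivf_liminf F x = ivl_Sup ((\<lambda>\<delta>. ivl_Inf (F ` ball x \<delta>)) ` {0<..})"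

definition gH_lsc :: "('a::metric_space \<Rightarrow> ereal interval) \<Rightarrow> bool" where
  "gH_lsc F \<longleftrightarrow> (\<forall>x. F x \<preceq> ivf_liminf F x)"

text \<open>
  The derivative is only considered at points of the domain: where \<open>F\<close> is \<open>+\<infinity>\<close> the difference
  quotient contains the meaningless \<open>\<infinity> - \<infinity>\<close> (already for \<open>d = 0\<close>). At a point where \<open>F\<close> is
  \<open>-\<infinity>\<close> the quotient is \<open>+\<infinity>\<close> by the \<^typ>\<open>ereal\<close> rule \<open>a - (- \<infinity>) = \<infinity>\<close> for every \<open>a\<close>.
  Limits are taken endpointwise and may be infinite; the topology that the library puts on
  intervals is not used.
\<close>

definition has_gH_dirderiv ::
  "('a::real_vector \<Rightarrow> ereal interval) \<Rightarrow> 'a \<Rightarrow> 'a \<Rightarrow> ereal interval \<Rightarrow> bool" where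
  "has_gH_dirderiv F x d D \<longleftrightarrow> x \<in> ivf_dom UNIV F \<and>
     ((\<lambda>t. lower ((1 / t) \<odot>\<^sub>I (F (x + t *\<^sub>R d) \<ominus>\<^sub>g\<^sub>H F x))) \<longlongrightarrow> lower D) (at_right 0) \<and>
     ((\<lambda>t. upper ((1 / t) \<odot>\<^sub>I (F (x + t *\<^sub>R d) \<ominus>\<^sub>g\<^sub>H F x))) \<longlongrightarrow> upper D) (at_right 0)"

definition gH_dir_differentiable ::
  "('a::real_vector \<Rightarrow> ereal interval) \<Rightarrow> 'a \<Rightarrow> 'a \<Rightarrow> bool" where
  "gH_dir_differentiable F x d \<longleftrightarrow> (\<exists>D. has_gH_dirderiv F x d D)"

definition gH_dirderiv ::
  "('a::real_vector \<Rightarrow> ereal interval) \<Rightarrow> 'a \<Rightarrow> 'a \<Rightarrow> ereal interval" where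
  "gH_dirderiv F x d = (THE D. has_gH_dirderiv F x d D)"

lemma has_gH_dirderiv_unique:
  assumes "has_gH_dirderiv F x d D" "has_gH_dirderiv F x d E"
  shows "D = E"
  using assms unfolding has_gH_dirderiv_def interval_eq_iff
  by (meson tendsto_unique trivial_limit_at_right_real)

lemma gH_dirderiv_eqI: "has_gH_dirderiv F x d D \<Longrightarrow> gH_dirderiv F x d = D"
  unfolding gH_dirderiv_def by (blast intro: has_gH_dirderiv_unique)

definition tangent_cone :: "'a::real_normed_vector set \<Rightarrow> 'a \<Rightarrow> 'a set" where
  "tangent_cone A x = closure (\<Union>t\<in>{0<..}. (\<lambda>a. (a - x) /\<^sub>R t) ` A)"

definition weak_sharp_minima ::
  "('a::metric_space \<Rightarrow> ereal interval) \<Rightarrow> 'a set \<Rightarrow> 'a set \<Rightarrow> real \<Rightarrow> bool" where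
  "weak_sharp_minima F S Sbar \<alpha> \<longleftrightarrow>
     (\<forall>xbar\<in>Sbar. \<forall>x\<in>S. F xbar + interval_of (ereal (\<alpha> * infdist x Sbar)) \<preceq> F x)"

end

(* For a convex function that is finite at x, the difference quotient in t is monotone in the
   endpointwise order, so the directional derivative at x exists and is the infimum of the
   quotients; a lower bound on the derivative is therefore a growth condition on the function.
   Sharp minima give the bound on the derivative because Sbar - x, scaled by 1 / t, lies in the
   tangent cone. Conversely, a nonnegative derivative in the directions within Sbar gives
   Fo x \<le> Fo p for the closest point p of Sbar to y, and the derivative at p in the
   direction y - p, which is normal to Sbar, is at least \<alpha> times the distance from y to Sbar.
   Where Fo is -\<infinity>, the derivative is +\<infinity> and both conditions are trivial. *)

theory Submission
  imports Defs
begin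

section \<open>Difference quotients of interval-valued functions\<close>

definition gH_quotient ::
  "('a::real_vector \<Rightarrow> ereal interval) \<Rightarrow> 'a \<Rightarrow> 'a \<Rightarrow> real \<Rightarrow> ereal interval" where
  "gH_quotient F x d t = (1 / t) \<odot>\<^sub>I (F (x + t *\<^sub>R d) \<ominus>\<^sub>g\<^sub>H F x)"

lemma lower_gH_quotient:
  "t > 0 \<Longrightarrow> lower (gH_quotient F x d t) =
     ereal (1 / t) * min (lower (F (x + t *\<^sub>R d)) - lower (F x)) (upper (F (x + t *\<^sub>R d)) - upper (F x))"
  and upper_gH_quotient:
  "t > 0 \<Longrightarrow> upper (gH_quotient F x d t) =
     ereal (1 / t) * max (lower (F (x + t *\<^sub>R d)) - lower (F x)) (upper (F (x + t *\<^sub>R d)) - upper (F x))"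
  by (simp_all add: gH_quotient_def lower_ivl_scale upper_ivl_scale lower_ivl_gH_diff upper_ivl_gH_diff)

lemma ereal_mult_min:
  fixes a b c :: ereal
  assumes "c \<ge> 0"
  shows "c * min a b = min (c * a) (c * b)"
  using ereal_mult_left_mono[OF _ assms] by (auto simp: min_def intro: antisym)

lemma ereal_mult_max:
  fixes a b c :: ereal
  assumes "c \<ge> 0"
  shows "c * max a b = max (c * a) (c * b)"
  using ereal_mult_left_mono[OF _ assms] by (auto simp: max_def intro: antisym)

text \<open>Chord slopes from a fixed point increase: subtract b from the bound and divide by s. As
  b is real, no difference is ambiguous: q = \<infinity> makes the right side \<infinity>, and q =
  -\<infinity> forces p = -\<infinity>.\<close>

lemma convex_bound_imp_quotient_le:
  fixes p q :: ereal and b s t :: real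
  assumes "0 < s" "s \<le> t" "p \<le> ereal (1 - s / t) * ereal b + ereal (s / t) * q"
  shows "ereal (1 / s) * (p - ereal b) \<le> ereal (1 / t) * (q - ereal b)"
proof (cases q)
  case (real r)
  show ?thesis
  proof (cases p)
    case (real u)
    have "u \<le> (1 - s / t) * b + s / t * r"
      using assms(3) \<open>q = ereal r\<close> real by simp
    then have "(u - b) / s \<le> (s / t * (r - b)) / s"
      using assms(1) by (intro divide_right_mono) (auto simp: algebra_simps diff_divide_distrib)
    also have "\<dots> = (r - b) / t"
      using assms(1) by simp
    finally show ?thesis
      using \<open>q = ereal r\<close> real by simp
  qed (use assms real in auto)
qed (use assms in auto)

section \<open>Convexity, endpoint by endpoint\<close>

lemma ivf_convex_onD_endpoint:
  assumes "ivf_convex_on UNIV F" "0 \<le> r" "r \<le> 1"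
  shows "lower (F ((1 - r) *\<^sub>R x + r *\<^sub>R y)) \<le> ereal (1 - r) * lower (F x) + ereal r * lower (F y)"
    and "upper (F ((1 - r) *\<^sub>R x + r *\<^sub>R y)) \<le> ereal (1 - r) * upper (F x) + ereal r * upper (F y)"
proof -
  have "F ((1 - r) *\<^sub>R x + r *\<^sub>R y) \<preceq> (1 - r) \<odot>\<^sub>I F x + r \<odot>\<^sub>I F y"
    using assms unfolding ivf_convex_on_def by auto
  then show "lower (F ((1 - r) *\<^sub>R x + r *\<^sub>R y)) \<le> ereal (1 - r) * lower (F x) + ereal r * lower (F y)"
    and "upper (F ((1 - r) *\<^sub>R x + r *\<^sub>R y)) \<le> ereal (1 - r) * upper (F x) + ereal r * upper (F y)"
    using assms by (auto simp: ivl_le_def lower_ivl_scale upper_ivl_scale)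
qed

text \<open>Carries convexity over to the constrained function: segments between points of
  \<open>S\<close> stay in \<open>S\<close>, and any other combination with positive weights is
  bounded by \<infinity>.\<close>

lemma ivf_convex_on_extend_infinity:
  assumes "ivf_convex_on UNIV F" "convex S" "\<And>x. G x = (if x \<in> S then F x else interval_of \<infinity>)"
  shows "ivf_convex_on UNIV G"
  unfolding ivf_convex_on_def
proof (intro conjI ballI impI)
  fix x y and r r' :: real
  assume r: "r \<in> {0..1}" "r' \<in> {0..1}" "r + r' = 1"
  consider "x \<in> S" "y \<in> S" | "r = 0" | "r' = 0" | "r > 0" "r' > 0" "x \<notin> S \<or> y \<notin> S"
    using r by force
  then show "G (r *\<^sub>R x + r' *\<^sub>R y) \<preceq> r \<odot>\<^sub>I G x + r' \<odot>\<^sub>I G y"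
  proof cases
    case 1
    then have "r *\<^sub>R x + r' *\<^sub>R y \<in> S"
      using r assms(2) by (auto simp: convex_def)
    with 1 r assms(1) show ?thesis
      unfolding ivf_convex_on_def assms(3) by auto
  next
    case 2
    \<comment> \<open>The other weight is 1 and 0 * \<infinity> = 0 in \<open>ereal\<close>, so the
      right side is just \<open>G y\<close>.\<close>
    with r show ?thesis
      by (auto simp: ivl_le_def lower_ivl_scale upper_ivl_scale simp flip: zero_ereal_def one_ereal_def)
  next
    case 3
    with r show ?thesis
      by (auto simp: ivl_le_def lower_ivl_scale upper_ivl_scale simp flip: zero_ereal_def one_ereal_def)
  next
    case 4
    \<comment> \<open>A positive weight keeps \<infinity>, and in a sum \<infinity> absorbs even
      -\<infinity>, so both endpoints on the right are \<infinity>.\<close>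
    then show ?thesis
      by (auto simp: assms(3) ivl_le_def lower_ivl_scale upper_ivl_scale)
  qed
qed simp

text \<open>Both endpoint functions are convex, so their quotients are monotone; the min and max in
  the gH-difference preserve this.\<close>

lemma gH_quotient_mono:
  assumes "ivf_convex_on UNIV F" "F x \<in> IR" "0 < s" "s \<le> t"
  shows "gH_quotient F x d s \<preceq> gH_quotient F x d t"
proof -
  obtain a b where ab: "lower (F x) = ereal a" "upper (F x) = ereal b"
    using assms(2) by (auto simp: IR_def)
  have eq: "(1 - s / t) *\<^sub>R x + (s / t) *\<^sub>R (x + t *\<^sub>R d) = x + s *\<^sub>R d"
    using assms by (simp add: algebra_simps)
  note convex = ivf_convex_onD_endpoint[OF assms(1), of "s / t" x "x + t *\<^sub>R d", unfolded eq ab]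
  have "ereal (1 / s) * (lower (F (x + s *\<^sub>R d)) - ereal a) \<le> ereal (1 / t) * (lower (F (x + t *\<^sub>R d)) - ereal a)"
    "ereal (1 / s) * (upper (F (x + s *\<^sub>R d)) - ereal b) \<le> ereal (1 / t) * (upper (F (x + t *\<^sub>R d)) - ereal b)"
    using assms by (auto intro!: convex_bound_imp_quotient_le convex)
  then show ?thesis
    using assms by (auto simp: ivl_le_def lower_gH_quotient upper_gH_quotient ereal_mult_min ereal_mult_max ab
        intro: min.coboundedI1 min.coboundedI2 max.coboundedI1 max.coboundedI2 simp del: times_ereal.simps)
qed

section \<open>The directional derivative as a limit of quotients\<close>

text \<open>Any c above the infimum exceeds some value f u, and monotonicity keeps f below c between
  a and u. For \<open>ereal\<close> the limit may be -\<infinity>.\<close>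

lemma mono_on_tendsto_Inf_at_right:
  fixes f :: "real \<Rightarrow> 'a::{complete_linorder,linorder_topology}"
  assumes "mono_on {a<..} f"
  shows "(f \<longlongrightarrow> (INF t\<in>{a<..}. f t)) (at_right a)"
proof (rule order_tendstoI)
  fix c assume "c < (INF t\<in>{a<..}. f t)"
  then have "\<forall>t\<in>{a<..}. c < f t"
    by (meson INF_lower less_le_trans)
  then show "\<forall>\<^sub>F t in at_right a. c < f t"
    by (auto simp: eventually_at_filter)
next
  fix c assume "(INF t\<in>{a<..}. f t) < c"
  then obtain u where u: "u > a" "f u < c"
    by (auto simp: INF_less_iff)
  then have "\<forall>t>a. t < u \<longrightarrow> f t < c"
    using assms by (meson greaterThan_iff le_less_trans less_imp_le monotone_onD)
  then show "\<forall>\<^sub>F t in at_right a. f t < c"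
    using u(1) eventually_at_right by blast
qed

lemma convex_has_gH_dirderiv:
  assumes "ivf_convex_on UNIV F" "F x \<in> IR"
  shows "has_gH_dirderiv F x d (ivl_Inf (gH_quotient F x d ` {0<..}))"
proof -
  have "x \<in> ivf_dom UNIV F"
    using assms(2) by (auto simp: ivf_dom_def ivl_less_def ivl_le_def IR_def)
  moreover have "mono_on {0<..} (\<lambda>t. lower (gH_quotient F x d t))"
    "mono_on {0<..} (\<lambda>t. upper (gH_quotient F x d t))"
    using gH_quotient_mono[OF assms] by (auto simp: monotone_on_def ivl_le_def)
  ultimately show ?thesis
    using mono_on_tendsto_Inf_at_right
    by (auto simp: has_gH_dirderiv_def lower_ivl_Inf upper_ivl_Inf image_image simp flip: gH_quotient_def)
qed

text \<open>The rule a - (-\<infinity>) = \<infinity> makes every quotient \<infinity>, whatever the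
  value at x + t d.\<close>

lemma minus_infinity_has_gH_dirderiv:
  assumes "F x = interval_of (- \<infinity>)"
  shows "has_gH_dirderiv F x d (interval_of \<infinity>)"
proof -
  have "lower (gH_quotient F x d t) = \<infinity>" "upper (gH_quotient F x d t) = \<infinity>" if "t > 0" for t
    using that assms by (auto simp: lower_gH_quotient upper_gH_quotient)
  then have "\<forall>\<^sub>F t in at_right 0. lower (gH_quotient F x d t) = \<infinity>"
    "\<forall>\<^sub>F t in at_right 0. upper (gH_quotient F x d t) = \<infinity>"
    by (auto simp: eventually_at_filter)
  moreover have "x \<in> ivf_dom UNIV F"
    using assms by (auto simp: ivf_dom_def ivl_less_def ivl_le_def interval_eq_iff)
  ultimately show ?thesis
    by (auto simp: has_gH_dirderiv_def tendsto_eventually simp flip: gH_quotient_def)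
qed

lemma le_ivl_Inf: "(\<And>A. A \<in> M \<Longrightarrow> B \<preceq> A) \<Longrightarrow> B \<preceq> ivl_Inf M"
  by (auto simp: ivl_le_def lower_ivl_Inf upper_ivl_Inf intro: INF_greatest)

lemma ivl_add_le_antimono:
  assumes "A + interval_of c \<preceq> B" "c' \<le> c"
  shows "A + interval_of c' \<preceq> B"
  using assms order_trans[OF add_left_mono[OF assms(2)]] by (simp add: ivl_le_def)

text \<open>A point lies below an interval as soon as it lies below the lower endpoint. For the
  quotient that endpoint is a minimum, so the bound controls both endpoints of \<open>F\<close> at
  once.\<close>

lemma interval_of_le_gH_quotient_iff:
  assumes "F x \<in> IR" "t > 0"
  shows "interval_of (ereal c) \<preceq> gH_quotient F x d t \<longleftrightarrow>
    F x + interval_of (ereal (t * c)) \<preceq> F (x + t *\<^sub>R d)"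
proof -
  obtain a b where ab: "lower (F x) = ereal a" "upper (F x) = ereal b"
    using assms(1) by (auto simp: IR_def)
  have *: "ereal c \<le> ereal (1 / t) * (p - ereal a) \<longleftrightarrow> ereal a + ereal (t * c) \<le> p" for p a
    using assms(2) by (cases p) (auto simp: field_simps)
  have "ereal c \<le> lower (gH_quotient F x d t) \<longleftrightarrow> F x + interval_of (ereal (t * c)) \<preceq> F (x + t *\<^sub>R d)"
    using assms(2) by (simp add: lower_gH_quotient ereal_mult_min ab * ivl_le_def del: times_ereal.simps plus_ereal.simps)
  then show ?thesis
    using order_trans[OF _ lower_le_upper] by (auto simp: ivl_le_def)
qed

text \<open>The quotient at t = 1 reaches \<open>y\<close> itself, and the derivative, being the
  infimum, lies below it.\<close>

lemma gH_dirderiv_lower_bound_imp_le: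
  assumes "ivf_convex_on UNIV F" "F x \<in> IR"
    and "interval_of (ereal c) \<preceq> gH_dirderiv F x (y - x)"
  shows "F x + interval_of (ereal c) \<preceq> F y"
proof -
  have "gH_dirderiv F x (y - x) = ivl_Inf (gH_quotient F x (y - x) ` {0<..})"
    using assms by (intro gH_dirderiv_eqI convex_has_gH_dirderiv)
  then have "interval_of (ereal c) \<preceq> gH_quotient F x (y - x) 1"
    using assms(3) by (auto simp: ivl_le_def lower_ivl_Inf upper_ivl_Inf le_INF_iff)
  then show ?thesis
    using assms(2) by (simp add: interval_of_le_gH_quotient_iff)
qed

section \<open>Distances to the tangent cone\<close>

lemma le_infdist:
  assumes "A \<noteq> {}" "\<And>a. a \<in> A \<Longrightarrow> c \<le> dist x a"
  shows "c \<le> infdist x A"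
  using assms by (auto simp: infdist_notempty intro: cINF_greatest)

lemma tangent_coneI: "a \<in> A \<Longrightarrow> t > 0 \<Longrightarrow> (a - x) /\<^sub>R t \<in> tangent_cone A x"
  unfolding tangent_cone_def by (rule closure_subset[THEN subsetD]) auto

text \<open>Each a in \<open>A\<close> provides the cone element (a - x) / t, whose distance from d,
  times t, is the distance from x + t d to a.\<close>

lemma infdist_tangent_cone_le:
  assumes "A \<noteq> {}" "t > 0"
  shows "t * infdist d (tangent_cone A x) \<le> infdist (x + t *\<^sub>R d) A"
proof (rule le_infdist[OF assms(1)])
  fix a assume "a \<in> A"
  then have "infdist d (tangent_cone A x) \<le> dist d ((a - x) /\<^sub>R t)"
    by (intro infdist_le tangent_coneI assms)
  then have "t * infdist d (tangent_cone A x) \<le> norm (t *\<^sub>R (d - (a - x) /\<^sub>R t))"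
    using assms(2) by (simp add: dist_norm)
  also have "t *\<^sub>R (d - (a - x) /\<^sub>R t) = x + t *\<^sub>R d - a"
    using assms(2) by (simp add: algebra_simps)
  finally show "t * infdist d (tangent_cone A x) \<le> dist (x + t *\<^sub>R d) a"
    by (simp add: dist_norm)
qed

text \<open>
  The vector from the closest point to \<open>y\<close> is normal to \<open>A\<close>, so the tangent cone lies in the
  polar half-space, in which \<open>0\<close> is the point nearest to this vector.
\<close>
lemma norm_le_infdist_tangent_cone_closest_point:
  fixes A :: "'a::euclidean_space set" and y :: 'a
  assumes "A \<noteq> {}" "closed A" "convex A"
  defines "p \<equiv> closest_point A y"
  shows "norm (y - p) \<le> infdist (y - p) (tangent_cone A p)"
proof -
  have p: "p \<in> A"
    using assms by (simp add: closest_point_in_set)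
  have "(y - p) \<bullet> ((a - p) /\<^sub>R t) \<le> 0" if "a \<in> A" "t > 0" for a t
    using closest_point_dot[OF assms(3,2) that(1), of y] that(2)
    by (simp add: p_def mult_nonneg_nonpos)
  then have "tangent_cone A p \<subseteq> {z. (y - p) \<bullet> z \<le> 0}"
    unfolding tangent_cone_def by (intro closure_minimal closed_halfspace_le) auto
  moreover have "norm (y - p) \<le> dist (y - p) z" if "(y - p) \<bullet> z \<le> 0" for z
  proof -
    have "(norm (y - p))\<^sup>2 \<le> (norm (y - p))\<^sup>2 - 2 * ((y - p) \<bullet> z) + (norm z)\<^sup>2"
      using that zero_le_power2[of "norm z"] by linarith
    also have "\<dots> = (norm (y - p - z))\<^sup>2"
      by (simp add: power2_norm_eq_inner inner_diff inner_commute)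
    finally have "(norm (y - p))\<^sup>2 \<le> (norm (y - p - z))\<^sup>2" .
    then show ?thesis
      by (simp add: dist_norm)
  qed
  ultimately show ?thesis
    \<comment> \<open>The cone element at t = 1 witnesses that the cone is nonempty, as
      \<open>le_infdist\<close> requires.\<close>
    using tangent_coneI[OF p, of 1] by (intro le_infdist) auto
qed

theorem theorem9:
  fixes F Fo :: "real ^ 'n \<Rightarrow> ereal interval"
    and S Sbar :: "(real ^ 'n) set"
    and \<alpha> :: real
  assumes "\<And>x. F x \<in> IR_ext"
    and "gH_lsc F"
    and "ivf_convex_on UNIV F"
    and "Sbar \<noteq> {}" and "closed Sbar" and "convex Sbar"
    and "S \<noteq> {}" and "closed S" and "convex S"
    and "Sbar \<subseteq> S"
    and "ivf_dom UNIV F \<inter> S \<noteq> {}"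
    and "\<And>x. Fo x = (if x \<in> S then F x else interval_of \<infinity>)"
    and "\<alpha> > 0"
  shows "weak_sharp_minima F S Sbar \<alpha> \<longleftrightarrow>
    (\<forall>x\<in>Sbar. \<forall>d. gH_dir_differentiable Fo x d \<and>
       interval_of (ereal (\<alpha> * infdist d (tangent_cone Sbar x))) \<preceq> gH_dirderiv Fo x d)"
proof (intro iffI ballI allI)
  note Fo = assms(12)
  have convex_Fo: "ivf_convex_on UNIV Fo"
    using assms(3,9,12) by (rule ivf_convex_on_extend_infinity)
  {
    fix x d
    assume wsm: "weak_sharp_minima F S Sbar \<alpha>" and x: "x \<in> Sbar"
    \<comment> \<open>An infinite value at a sharp minimum would make \<open>F\<close> infinite on
      all of \<open>S\<close>.\<close>
    have "F x \<noteq> interval_of \<infinity>"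
    proof
      assume inf: "F x = interval_of \<infinity>"
      have "F z = interval_of \<infinity>" if "z \<in> S" for z
        using wsm x that inf by (force simp: weak_sharp_minima_def ivl_le_def interval_eq_iff)
      with assms(11) show False
        by (auto simp: ivf_dom_def ivl_less_def)
    qed
    then consider "Fo x \<in> IR" | "Fo x = interval_of (- \<infinity>)"
      using assms(1)[of x] assms(10) x by (auto simp: IR_ext_def Fo)
    then have "\<exists>D. has_gH_dirderiv Fo x d D \<and>
      interval_of (ereal (\<alpha> * infdist d (tangent_cone Sbar x))) \<preceq> D"
    proof cases
      case 1
      have "interval_of (ereal (\<alpha> * infdist d (tangent_cone Sbar x))) \<preceq> gH_quotient Fo x d t"
        if "t > 0" for t
      proof (cases "x + t *\<^sub>R d \<in> S")
        case True
        have "Fo x + interval_of (ereal (\<alpha> * infdist (x + t *\<^sub>R d) Sbar)) \<preceq> Fo (x + t *\<^sub>R d)"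
          using wsm True x assms(10) by (auto simp: weak_sharp_minima_def Fo)
        moreover have "ereal (t * (\<alpha> * infdist d (tangent_cone Sbar x))) \<le> ereal (\<alpha> * infdist (x + t *\<^sub>R d) Sbar)"
          using infdist_tangent_cone_le[OF assms(4) that, of d x] assms(13)
          by (simp add: mult.left_commute)
        ultimately have "Fo x + interval_of (ereal (t * (\<alpha> * infdist d (tangent_cone Sbar x)))) \<preceq> Fo (x + t *\<^sub>R d)"
          by (rule ivl_add_le_antimono)
        with 1 that show ?thesis
          by (simp add: interval_of_le_gH_quotient_iff)
      next
        case False
        \<comment> \<open>Outside \<open>S\<close> the value \<infinity> satisfies every growth
          bound.\<close>
        then have "Fo (x + t *\<^sub>R d) = interval_of \<infinity>"
          by (simp add: Fo)
        then have "Fo x + interval_of c \<preceq> Fo (x + t *\<^sub>R d)" for c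
          by (simp add: ivl_le_def)
        with 1 that show ?thesis
          by (simp add: interval_of_le_gH_quotient_iff)
      qed
      with convex_has_gH_dirderiv[OF convex_Fo 1] show ?thesis
        by (blast intro: le_ivl_Inf)
    next
      case 2
      show ?thesis
        using minus_infinity_has_gH_dirderiv[of Fo, OF 2]
        by (intro exI[of _ "interval_of \<infinity>"]) (simp add: ivl_le_def)
    qed
    then show "gH_dir_differentiable Fo x d \<and>
       interval_of (ereal (\<alpha> * infdist d (tangent_cone Sbar x))) \<preceq> gH_dirderiv Fo x d"
      by (auto simp: gH_dir_differentiable_def gH_dirderiv_eqI)
  next
    assume R: "\<forall>x\<in>Sbar. \<forall>d. gH_dir_differentiable Fo x d \<and>
       interval_of (ereal (\<alpha> * infdist d (tangent_cone Sbar x))) \<preceq> gH_dirderiv Fo x d"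
    have bound: "Fo x + interval_of (ereal (\<alpha> * infdist (y - x) (tangent_cone Sbar x))) \<preceq> Fo y"
      if "x \<in> Sbar" for x y
    proof -
      \<comment> \<open>Differentiability carries membership in the domain, which excludes the value
        \<infinity> at x.\<close>
      have "x \<in> ivf_dom UNIV Fo"
        using R that by (auto simp: gH_dir_differentiable_def has_gH_dirderiv_def)
      then consider "Fo x \<in> IR" | "Fo x = interval_of (- \<infinity>)"
        using assms(1)[of x] by (auto simp: ivf_dom_def ivl_less_def IR_ext_def Fo split: if_splits)
      then show ?thesis
      proof cases
        case 1
        with R that show ?thesis
          by (intro gH_dirderiv_lower_bound_imp_le convex_Fo) auto
      next
        case 2
        then show ?thesis
          by (simp add: ivl_le_def)
      qed
    qed
    show "weak_sharp_minima F S Sbar \<alpha>"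
      unfolding weak_sharp_minima_def
    proof (intro ballI)
      fix x y
      assume x: "x \<in> Sbar" and y: "y \<in> S"
      define p where "p = closest_point Sbar y"
      have p: "p \<in> Sbar"
        using assms(4,5) by (simp add: p_def closest_point_in_set)
      \<comment> \<open>With t = 1, \<open>p - x\<close> itself is in the cone, so the distance term
        of \<open>bound\<close> vanishes.\<close>
      have "infdist (p - x) (tangent_cone Sbar x) = 0"
        using tangent_coneI[OF p, of 1 x] by simp
      with bound[OF x, of p] have xp: "Fo x \<preceq> Fo p"
        by (simp add: ivl_le_def)
      \<comment> \<open>The distance from \<open>y\<close> to \<open>Sbar\<close> is
        \<open>norm (y - p)\<close>, and normality of \<open>y - p\<close> bounds it by the distance
        to the cone at \<open>p\<close>.\<close>
      have "\<alpha> * infdist y Sbar \<le> \<alpha> * infdist (y - p) (tangent_cone Sbar p)"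
        using norm_le_infdist_tangent_cone_closest_point[OF assms(4-6), of y] assms(13)
        by (simp add: infdist_eq_setdist setdist_closest_point[OF assms(5,4)] dist_norm p_def)
      with xp have "Fo x + interval_of (ereal (\<alpha> * infdist y Sbar)) \<preceq>
          Fo p + interval_of (ereal (\<alpha> * infdist (y - p) (tangent_cone Sbar p)))"
        by (auto simp: ivl_le_def intro: add_mono)
      with bound[OF p, of y] have "Fo x + interval_of (ereal (\<alpha> * infdist y Sbar)) \<preceq> Fo y"
        by (auto simp: ivl_le_def)
      then show "F x + interval_of (ereal (\<alpha> * infdist y Sbar)) \<preceq> F y"
        using x y assms(10) by (auto simp: Fo)
    qed
  }
qed

end
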